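(* Let $d\ge1$, $N\ge2$, let $p\in(2,2^* )$, and let $g:\mathbb{C}^N\to\mathbb{R}$ be twice continuously differentiable (as a function on $\mathbb{R}^{2N}$) with $g(rz)=r^p g(z)$ for all $z\in\mathbb{C}^N$, $r\ge0$. Let $F_j=\frac2p\partial_{\overline{z_j}}g$. Let $\mathbf{w}\in\partial B$ and $a>0$. Then $\mathcal{R}(\mathbf{w},\omega,a)\subset\mathcal{A}_\omega$ holds for all $\omega>0$ if and only if $\mathbf{w}$ is a critical point of $g|_{\partial B}$ and $a=-g(\mathbf{w})>0$.
   Context: $2^*=\infty$ for $d=1,2$ and $2^*=2d/(d-2)$ for $d\ge3$. With $z=x+iy$, $\partial_{\overline z}=\frac12(\partial_x+i\partial_y)$. $\partial B=\{z\in\mathbb{C}^N: \sum_j|z_j|^2=1\}$ (the unit sphere, a smooth real manifold). $\mathcal{A}_\omega$ is the set of nonzero $\Phi=(\phi_1,\dots,\phi_N)\in(H^1(\mathbb{R}^d))^N$ (complex-valued components) solving $-\Delta\phi_j+\omega\phi_j=-F_j(\Phi)$ on $\mathbb{R}^d$ for $j=1,\dots,N$. $Q\in H^1(\mathbb{R}^d)$ is the positive radial solution of $-\Delta Q+Q=Q^{p-1}$; for $\omega,a>0$, $Q_{\omega,a}(x)=(\omega/a)^{1/(p-2)}Q(\sqrt\omega x)$. For $\mathbf{w}\in\partial B$, $\mathcal{R}(\mathbf{w},\omega,a)=\{\mathbf{w}Q_{\omega,a}(\cdot-y): y\in\mathbb{R}^d\}$. *)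

theory Defs
  imports "HOL-Analysis.Analysis"
begin

section \<open>Differentiable functions\<close>

definition dir_deriv :: "'a::real_normed_vector \<Rightarrow> ('a \<Rightarrow> 'b::real_normed_vector) \<Rightarrow> 'a \<Rightarrow> 'b" where
  "dir_deriv v f x = frechet_derivative f (at x) v"

text \<open>Differentiability is always over the reals, so for a domain such as \<open>complex^'n\<close> this
  is the class \<open>C^k\<close> on the underlying real space of dimension \<open>2 * CARD('n)\<close>.\<close>

fun C_k :: "nat \<Rightarrow> ('a::real_normed_vector \<Rightarrow> 'b::real_normed_vector) \<Rightarrow> bool" where
  "C_k 0 f \<longleftrightarrow> continuous_on UNIV f"
| "C_k (Suc k) f \<longleftrightarrow> (\<forall>x. f differentiable (at x)) \<and> (\<forall>v. C_k k (dir_deriv v f))"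

definition smooth :: "('a::real_normed_vector \<Rightarrow> 'b::real_normed_vector) \<Rightarrow> bool" where
  "smooth f \<longleftrightarrow> (\<forall>k. C_k k f)"

definition laplacian :: "(real^'d \<Rightarrow> real) \<Rightarrow> real^'d \<Rightarrow> real" where
  "laplacian f x = (\<Sum>i\<in>UNIV. dir_deriv (axis i 1) (dir_deriv (axis i 1) f) x)"

definition dbar :: "'n \<Rightarrow> (complex^'n \<Rightarrow> real) \<Rightarrow> complex^'n \<Rightarrow> complex" where
  "dbar j g z = 1/2 * (complex_of_real (dir_deriv (axis j 1) g z)
                       + \<i> * complex_of_real (dir_deriv (axis j \<i>) g z))"

section \<open>Sobolev space and distributional equations\<close>

text \<open>Elements of function spaces are represented by Lebesgue measurable functions;
  \<open>H1\<close>, \<open>solves_distr\<close> and \<open>solution_set\<close> are invariant under changes on null sets.\<close>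

definition test_function :: "(real^'d \<Rightarrow> real) \<Rightarrow> bool" where
  "test_function \<psi> \<longleftrightarrow> smooth \<psi> \<and> compact (closure {x. \<psi> x \<noteq> 0})"

definition L2 :: "(real^'d \<Rightarrow> 'b::euclidean_space) \<Rightarrow> bool" where
  "L2 f \<longleftrightarrow> f \<in> borel_measurable lebesgue \<and> integrable lebesgue (\<lambda>x. (norm (f x))\<^sup>2)"

definition L1_loc :: "(real^'d \<Rightarrow> 'b::euclidean_space) \<Rightarrow> bool" where
  "L1_loc f \<longleftrightarrow> (\<forall>K. compact K \<longrightarrow> set_integrable lebesgue K f)"

definition weak_partial ::
    "'d \<Rightarrow> (real^'d \<Rightarrow> 'b::euclidean_space) \<Rightarrow> (real^'d \<Rightarrow> 'b) \<Rightarrow> bool" where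
  "weak_partial i f h \<longleftrightarrow> L1_loc f \<and> L1_loc h \<and>
     (\<forall>\<psi>. test_function \<psi> \<longrightarrow>
        (LINT x|lebesgue. dir_deriv (axis i 1) \<psi> x *\<^sub>R f x) = - (LINT x|lebesgue. \<psi> x *\<^sub>R h x))"

definition H1 :: "(real^'d \<Rightarrow> 'b::euclidean_space) \<Rightarrow> bool" where
  "H1 f \<longleftrightarrow> L2 f \<and> (\<forall>i. \<exists>h. L2 h \<and> weak_partial i f h)"

text \<open>\<open>- \<Delta> u + \<omega> u = f\<close> in the sense of distributions. Local integrability of \<open>f\<close> makes the right
  hand side a distribution; for the nonlinearities used below (of order \<open>p - 1\<close> with
  \<open>p < 2*\<close>, evaluated at \<open>H^1\<close> functions) it holds automatically by the Sobolev embedding.\<close>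

definition solves_distr ::
    "real \<Rightarrow> (real^'d \<Rightarrow> 'b::euclidean_space) \<Rightarrow> (real^'d \<Rightarrow> 'b) \<Rightarrow> bool" where
  "solves_distr \<omega> u f \<longleftrightarrow> L1_loc u \<and> L1_loc f \<and>
     (\<forall>\<psi>. test_function \<psi> \<longrightarrow>
        (LINT x|lebesgue. (- laplacian \<psi> x + \<omega> * \<psi> x) *\<^sub>R u x) = (LINT x|lebesgue. \<psi> x *\<^sub>R f x))"

section \<open>The system\<close>

definition two_star :: "nat \<Rightarrow> ereal" where
  "two_star d = (if d \<le> 2 then \<infinity> else ereal (2 * real d / (real d - 2)))"

definition unit_sphere :: "(complex^'n) set" where
  "unit_sphere = {z. (\<Sum>j\<in>UNIV. (cmod (z $ j))\<^sup>2) = 1}"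

text \<open>Vanishing of the differential of the restriction \<open>g|M\<close> to an embedded smooth
  submanifold \<open>M\<close>, with tangent vectors given by smooth curves in \<open>M\<close>. Curves defined on all of
  the real line suffice, since a curve on an interval around 0 can be reparametrised.\<close>

definition critical_point_on ::
    "('a::real_normed_vector \<Rightarrow> real) \<Rightarrow> 'a set \<Rightarrow> 'a \<Rightarrow> bool" where
  "critical_point_on g M w \<longleftrightarrow> w \<in> M \<and>
     (\<forall>\<gamma>::real \<Rightarrow> 'a. smooth \<gamma> \<and> range \<gamma> \<subseteq> M \<and> \<gamma> 0 = w \<longrightarrow>
        ((\<lambda>t. g (\<gamma> t)) has_real_derivative 0) (at 0))"

definition nonlin :: "real \<Rightarrow> (complex^'n \<Rightarrow> real) \<Rightarrow> 'n \<Rightarrow> complex^'n \<Rightarrow> complex" where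
  "nonlin p g j z = complex_of_real (2 / p) * dbar j g z"

definition solution_set ::
    "('n \<Rightarrow> complex^'n \<Rightarrow> complex) \<Rightarrow> real \<Rightarrow> (real^'d \<Rightarrow> complex^'n) set" where
  "solution_set F \<omega> = {\<Phi>. \<not> (AE x in lebesgue. \<Phi> x = 0) \<and>
     (\<forall>j. H1 (\<lambda>x. \<Phi> x $ j)) \<and>
     (\<forall>j. solves_distr \<omega> (\<lambda>x. \<Phi> x $ j) (\<lambda>x. - F j (\<Phi> x)))}"

text \<open>By classical results the positive radial solution exists and is unique (up to null sets)
  for \<open>2 < p < 2*\<close>.\<close>

definition ground_state :: "real \<Rightarrow> (real^'d \<Rightarrow> real) \<Rightarrow> bool" where
  "ground_state p Q \<longleftrightarrow> H1 Q \<and> (\<forall>x. Q x > 0) \<and> (\<forall>x y. norm x = norm y \<longrightarrow> Q x = Q y) \<and>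
     solves_distr 1 Q (\<lambda>x. Q x powr (p - 1))"

definition Q_scaled ::
    "real \<Rightarrow> (real^'d \<Rightarrow> real) \<Rightarrow> real \<Rightarrow> real \<Rightarrow> real^'d \<Rightarrow> real" where
  "Q_scaled p Q \<omega> a x = (\<omega> / a) powr (1 / (p - 2)) * Q (sqrt \<omega> *\<^sub>R x)"

definition R_set ::
    "real \<Rightarrow> (real^'d \<Rightarrow> real) \<Rightarrow> complex^'n \<Rightarrow> real \<Rightarrow> real \<Rightarrow> (real^'d \<Rightarrow> complex^'n) set" where
  "R_set p Q w \<omega> a = {(\<lambda>x. Q_scaled p Q \<omega> a (x - y) *\<^sub>R w) | y. True}"

end

theory Submission
  imports Defs
begin

text \<open>By scaling, \<open>u = Q_scaled p Q \<omega> a (\<cdot> - y)\<close> solves \<open>- \<Delta> u + \<omega> u = a u\<^sup>p\<^sup>-\<^sup>1\<close>, and \<open>F\<^sub>j\<close> is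
  homogeneous of degree \<open>p - 1\<close>; so \<open>u w\<close> solves the system iff \<open>a w\<^sub>j = - F\<^sub>j(w)\<close> for all \<open>j\<close> (test
  against a nonnegative bump, using \<open>u > 0\<close>). These equations say that the real differential of \<open>g\<close>
  at \<open>w\<close> is \<open>- p a \<langle>w, \<cdot>\<rangle>\<close>. Its tangential part vanishes iff \<open>w\<close> is critical, and by Euler's identity
  its radial part is \<open>p g(w)\<close>, which gives \<open>a = - g(w)\<close>.\<close>

section \<open>Calculus of \<open>C_k\<close> functions\<close>

lemma dir_deriv_eqI: "(f has_derivative f') (at x) \<Longrightarrow> dir_deriv v f x = f' v"
  unfolding dir_deriv_def by (metis frechet_derivative_at)

lemma has_derivative_dir_deriv:
  "f differentiable (at x) \<Longrightarrow> (f has_derivative (\<lambda>v. dir_deriv v f x)) (at x)"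
  unfolding dir_deriv_def using frechet_derivative_works by metis

text \<open>At the bottom this is continuity of differentiable functions; above it, the induction
  hypothesis applies to the directional derivatives. The product rule needs it, since each of its
  terms keeps one factor undifferentiated.\<close>

lemma C_k_Suc_D: "C_k (Suc k) f \<Longrightarrow> C_k k f"
proof (induction k arbitrary: f)
  case 0
  then show ?case
    by (auto intro!: continuous_at_imp_continuous_on differentiable_imp_continuous_within)
next
  case (Suc k)
  then show ?case by simp
qed

lemma C_k_const: "C_k k (\<lambda>x. c)"
proof (induction k arbitrary: c)
  case (Suc k)
  have "dir_deriv v (\<lambda>x::'a. c) = (\<lambda>x. 0)" for v
    by (rule ext) (simp add: dir_deriv_def)
  with Suc show ?case by simp
qed simp

lemma C_k_bounded_linear:
  assumes "bounded_linear f"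
  shows "C_k k f"
proof (cases k)
  case 0
  then show ?thesis using assms by (simp add: linear_continuous_on)
next
  case (Suc l)
  have "dir_deriv v f = (\<lambda>x. f v)" for v
    using dir_deriv_eqI[OF bounded_linear_imp_has_derivative[OF assms]] by blast
  then show ?thesis
    using assms by (simp add: Suc C_k_const bounded_linear_imp_differentiable)
qed

lemma C_k_add: "C_k k f \<Longrightarrow> C_k k g \<Longrightarrow> C_k k (\<lambda>x. f x + g x)"
proof (induction k arbitrary: f g)
  case 0
  then show ?case by (simp add: continuous_on_add)
next
  case (Suc k)
  have "dir_deriv v (\<lambda>x. f x + g x) = (\<lambda>x. dir_deriv v f x + dir_deriv v g x)" for v
    using Suc.prems
    by (intro ext dir_deriv_eqI has_derivative_add has_derivative_dir_deriv) auto
  with Suc show ?case by simp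
qed

lemma C_k_mult:
  fixes f g :: "'a::real_normed_vector \<Rightarrow> real"
  shows "C_k k f \<Longrightarrow> C_k k g \<Longrightarrow> C_k k (\<lambda>x. f x * g x)"
proof (induction k arbitrary: f g)
  case 0
  then show ?case by (simp add: continuous_on_mult)
next
  case (Suc k)
  have "dir_deriv v (\<lambda>x. f x * g x) = (\<lambda>x. f x * dir_deriv v g x + dir_deriv v f x * g x)" for v
    using Suc.prems
    by (intro ext dir_deriv_eqI has_derivative_mult has_derivative_dir_deriv) auto
  moreover have "C_k k f" "C_k k g"
    using Suc.prems by (blast intro: C_k_Suc_D)+
  ultimately show ?case
    using Suc by (simp add: C_k_add)
qed

lemma dir_deriv_affine:
  fixes f :: "'a::real_normed_vector \<Rightarrow> real"
  assumes "f differentiable (at (c *\<^sub>R x + b))"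
  shows "dir_deriv v (\<lambda>x. f (c *\<^sub>R x + b)) x = c * dir_deriv v f (c *\<^sub>R x + b)"
proof -
  have f: "(f has_derivative (\<lambda>v. dir_deriv v f (c *\<^sub>R x + b))) (at (c *\<^sub>R x + b))"
    using assms by (rule has_derivative_dir_deriv)
  have aff: "((\<lambda>x. c *\<^sub>R x + b) has_derivative (\<lambda>v. c *\<^sub>R v)) (at x)"
    by (auto intro!: derivative_eq_intros)
  have "dir_deriv v (\<lambda>x. f (c *\<^sub>R x + b)) x = dir_deriv (c *\<^sub>R v) f (c *\<^sub>R x + b)"
    by (rule dir_deriv_eqI) (rule has_derivative_compose[OF aff f])
  also have "\<dots> = c * dir_deriv v f (c *\<^sub>R x + b)"
    using linear_scale[OF has_derivative_linear[OF f]] by simp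
  finally show ?thesis .
qed

text \<open>The outer factor \<open>c\<close> makes the induction close: differentiating pulls out
  \<open>s\<close> by the chain rule, and \<open>c * s\<close> takes the place of
  \<open>c\<close>.\<close>

lemma C_k_affine:
  fixes f :: "'a::real_normed_vector \<Rightarrow> real"
  shows "C_k k f \<Longrightarrow> C_k k (\<lambda>x. c *\<^sub>R f (s *\<^sub>R x + b))"
proof (induction k arbitrary: f c)
  case 0
  then show ?case
    by (auto intro!: continuous_intros continuous_on_compose2[of UNIV f])
next
  case (Suc k)
  have df: "f differentiable (at x)" for x
    using Suc.prems by simp
  have aff: "(\<lambda>x. f (s *\<^sub>R x + b)) differentiable (at x)" for x
    using df by (rule differentiable_compose) simp
  then have "dir_deriv v (\<lambda>x. c *\<^sub>R f (s *\<^sub>R x + b)) x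
      = c *\<^sub>R dir_deriv v (\<lambda>x. f (s *\<^sub>R x + b)) x" for v x
    by (intro dir_deriv_eqI has_derivative_scaleR_right has_derivative_dir_deriv)
  then have "dir_deriv v (\<lambda>x. c *\<^sub>R f (s *\<^sub>R x + b))
      = (\<lambda>x. (c * s) *\<^sub>R dir_deriv v f (s *\<^sub>R x + b))" for v
    by (simp add: dir_deriv_affine[OF df] fun_eq_iff)
  moreover have "(\<lambda>x. c *\<^sub>R f (s *\<^sub>R x + b)) differentiable (at x)" for x
    using aff[of x] by (intro derivative_intros)
  ultimately show ?case
    using Suc by simp
qed

section \<open>A smooth bump function\<close>

text \<open>The power in front of exp(-1/t) makes the family closed under differentiation: the
  derivative of level \<open>n\<close> is a combination of levels \<open>n + 1\<close> and
  \<open>n + 2\<close>. Smoothness of exp(-1/t), extended by 0, thus follows by an induction over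
  all levels together.\<close>

definition flat_exp :: "nat \<Rightarrow> real \<Rightarrow> real" where
  "flat_exp n t = (if t > 0 then (1 / t) ^ n * exp (- (1 / t)) else 0)"

text \<open>From the right, put s = 1/t: then s^n / exp s tends to 0 as s goes to infinity. From the
  left the function is identically 0.\<close>

lemma flat_exp_tendsto_0: "(flat_exp n \<longlongrightarrow> 0) (at 0)"
proof -
  have "((\<lambda>t::real. (1 / t) ^ n * exp (- (1 / t))) \<longlongrightarrow> 0) (at_right 0)"
  proof -
    have "filterlim (\<lambda>t::real. 1 / t) at_top (at_right 0)"
      using filterlim_inverse_at_top_right by (simp add: inverse_eq_divide)
    then have "((\<lambda>t::real. (1 / t) ^ n / exp (1 / t)) \<longlongrightarrow> 0) (at_right 0)"
      by (rule filterlim_compose[OF tendsto_power_div_exp_0])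
    then show ?thesis by (simp add: exp_minus field_simps)
  qed
  then have "(flat_exp n \<longlongrightarrow> 0) (at_right 0)"
    by (rule Lim_transform_eventually)
      (auto simp: flat_exp_def eventually_at_filter)
  moreover have "(flat_exp n \<longlongrightarrow> 0) (at_left 0)"
    by (rule Lim_transform_eventually[OF tendsto_const])
      (auto simp: flat_exp_def eventually_at_filter)
  ultimately show ?thesis
    by (simp add: filterlim_split_at)
qed

lemma flat_exp_has_derivative:
  "(flat_exp n has_real_derivative (flat_exp (n + 2) t - real n * flat_exp (n + 1) t)) (at t)"
proof -
  consider "t > 0" | "t < 0" | "t = 0" by linarith
  then show ?thesis
  proof cases
    case 1
    have *: "((\<lambda>t. (1 / t) ^ n * exp (- (1 / t))) has_real_derivative
        ((1 / t) ^ (n + 2) * exp (- (1 / t)) - real n * ((1 / t) ^ (n + 1) * exp (- (1 / t))))) (at t)"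
    proof -
      have "((\<lambda>t. 1 / t) has_real_derivative - ((1 / t)\<^sup>2)) (at t)"
        using 1 by (auto intro!: derivative_eq_intros simp: power2_eq_square)
      from DERIV_power[OF this, of n]
      have D: "((\<lambda>t. (1 / t) ^ n) has_real_derivative - (real n * (1 / t) ^ (n + 1))) (at t)"
      proof (rule DERIV_cong)
        \<comment> \<open>For \<open>n = 0\<close> the exponent \<open>n - Suc 0\<close> truncates
          to 0, but the factor \<open>real n\<close> makes both sides vanish.\<close>
        show "real n * (- (q\<^sup>2) * q ^ (n - Suc 0)) = - (real n * q ^ (n + 1))" for q :: real
          by (cases n) (auto simp: power2_eq_square)
      qed
      have "((\<lambda>t. exp (- (1 / t))) has_real_derivative exp (- (1 / t)) * (1 / t)\<^sup>2) (at t)"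
        using 1 by (auto intro!: derivative_eq_intros simp: power2_eq_square)
      from DERIV_mult[OF D this] show ?thesis
        by (rule DERIV_cong) (simp add: algebra_simps power_add power2_eq_square)
    qed
    have "(flat_exp n has_real_derivative
        ((1 / t) ^ (n + 2) * exp (- (1 / t)) - real n * ((1 / t) ^ (n + 1) * exp (- (1 / t))))) (at t)"
      by (rule has_field_derivative_transform_within_open[OF *, of "{0<..}"])
        (use 1 in \<open>auto simp: flat_exp_def\<close>)
    with 1 show ?thesis by (simp add: flat_exp_def)
  next
    case 2
    have "(flat_exp n has_real_derivative 0) (at t)"
      by (rule has_field_derivative_transform_within_open[of "\<lambda>_. 0" _ _ "{..<0}"])
        (use 2 in \<open>auto simp: flat_exp_def\<close>)
    with 2 show ?thesis by (simp add: flat_exp_def)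
  next
    case 3
    \<comment> \<open>The difference quotient at 0 is \<open>flat_exp (Suc n)\<close> itself, so the
      limit computed before gives derivative 0.\<close>
    have "((\<lambda>h. (flat_exp n (0 + h) - flat_exp n 0) / h) \<longlongrightarrow> 0) (at 0)"
      by (rule Lim_transform_eventually[OF flat_exp_tendsto_0[of "Suc n"]])
        (auto simp: flat_exp_def eventually_at_filter)
    with 3 show ?thesis
      by (simp add: DERIV_def) (simp add: flat_exp_def)
  qed
qed

text \<open>This is exp(-1/(1 - |x|^2)) inside the unit ball and 0 outside. The squared norm, being
  a polynomial, keeps it smooth at the origin.\<close>

definition bump :: "'a::real_inner \<Rightarrow> real" where
  "bump x = flat_exp 0 (1 - x \<bullet> x)"

text \<open>The derivative along \<open>v\<close> is the linear function -2 (v \<bullet> x) times a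
  combination of the levels \<open>n + 1\<close> and \<open>n + 2\<close>. Hence the induction on
  \<open>k\<close> leaves \<open>n\<close> arbitrary.\<close>

lemma C_k_flat_exp_inner: "C_k k (\<lambda>x::'a::real_inner. flat_exp n (1 - x \<bullet> x))"
proof (induction k arbitrary: n)
  case 0
  have "continuous_on UNIV (flat_exp n)"
    using flat_exp_has_derivative
    by (blast intro: continuous_at_imp_continuous_on DERIV_isCont)
  then show ?case
    by (auto intro!: continuous_intros continuous_on_compose2[of UNIV "flat_exp n"])
next
  case (Suc k)
  have D: "((\<lambda>x::'a. flat_exp n (1 - x \<bullet> x)) has_derivative
      (\<lambda>v. (-2 * (v \<bullet> x)) * (flat_exp (n + 2) (1 - x \<bullet> x) + (- real n) * flat_exp (n + 1) (1 - x \<bullet> x))))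
      (at x)" for x
  proof -
    have "((\<lambda>x::'a. 1 - x \<bullet> x) has_derivative (\<lambda>v. -2 * (v \<bullet> x))) (at x)"
      by (auto intro!: derivative_eq_intros simp: inner_commute)
    from has_derivative_compose[OF this flat_exp_has_derivative[unfolded has_field_derivative_def]]
    show ?thesis by (rule has_derivative_eq_rhs) (auto simp: algebra_simps)
  qed
  have "dir_deriv v (\<lambda>x::'a. flat_exp n (1 - x \<bullet> x)) = (\<lambda>x. (-2 * (v \<bullet> x)) *
      (flat_exp (n + 2) (1 - x \<bullet> x) + (- real n) * flat_exp (n + 1) (1 - x \<bullet> x)))" for v
    by (intro ext dir_deriv_eqI D)
  then have "C_k k (dir_deriv v (\<lambda>x::'a. flat_exp n (1 - x \<bullet> x)))" for v
    by (simp only:) (intro C_k_mult C_k_add C_k_const Suc C_k_bounded_linear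
        bounded_linear_const_mult bounded_linear_inner_right)
  moreover have "(\<lambda>x::'a. flat_exp n (1 - x \<bullet> x)) differentiable (at x)" for x
    using D unfolding differentiable_def by blast
  ultimately show ?case by simp
qed

lemma bump_pos: "norm x < 1 \<Longrightarrow> bump x > 0"
  by (simp add: bump_def flat_exp_def dot_square_norm power_less_one_iff)

lemma bump_eq_0: "norm x \<ge> 1 \<Longrightarrow> bump x = 0"
  by (simp add: bump_def flat_exp_def dot_square_norm not_less one_le_power)

lemma bump_nonneg: "bump x \<ge> 0"
  by (simp add: bump_def flat_exp_def)

lemma bump_le_1: "bump x \<le> 1"
  by (simp add: bump_def flat_exp_def)

lemma test_function_bump: "test_function (bump :: real^'d \<Rightarrow> real)"
proof -
  have "{x::real^'d. bump x \<noteq> 0} \<subseteq> cball 0 1"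
    using bump_eq_0 by (force simp: not_le)
  then have "bounded {x::real^'d. bump x \<noteq> 0}"
    by (rule bounded_subset[OF bounded_cball])
  then have "compact (closure {x::real^'d. bump x \<noteq> 0})"
    by simp
  then show ?thesis
    unfolding test_function_def smooth_def bump_def[abs_def] using C_k_flat_exp_inner by blast
qed

text \<open>A vanishing integral of a nonnegative integrable function forces it to be 0 almost
  everywhere. As the integrand is positive on the open unit ball, that ball would be a null set. The
  positive value is later cancelled when two right hand sides are compared.\<close>

lemma bump_integral_pos:
  fixes f :: "real^'d \<Rightarrow> real"
  assumes "L1_loc f" and pos: "\<And>x. f x > 0"
  shows "(LINT x|lebesgue. bump x * f x) > 0"
proof -
  have int: "integrable lebesgue (\<lambda>x. indicator (cball 0 1) x *\<^sub>R f x)"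
    using assms(1) by (auto simp: L1_loc_def set_integrable_def)
  have "continuous_on UNIV (bump :: real^'d \<Rightarrow> real)"
    using test_function_bump[where 'd='d] unfolding test_function_def smooth_def
    by (metis C_k.simps(1))
  then have meas: "(bump :: real^'d \<Rightarrow> real) \<in> borel_measurable lebesgue"
    by (intro measurable_completion) (simp add: borel_measurable_continuous_onI)
  have eq: "(\<lambda>x. bump x * f x) = (\<lambda>x. bump x * (indicator (cball 0 1) x *\<^sub>R f x))"
    by (rule ext) (auto simp: indicator_def bump_eq_0)
  have le: "norm (bump x * f x) \<le> norm (indicator (cball 0 1) x *\<^sub>R f x)" for x
  proof -
    have "\<bar>bump x\<bar> * \<bar>f x\<bar> \<le> 1 * \<bar>f x\<bar>"
      by (intro mult_right_mono) (auto simp: bump_nonneg bump_le_1)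
    then show ?thesis
      by (auto simp: indicator_def bump_eq_0 abs_mult)
  qed
  \<comment> \<open>Since 0 \<le> \<open>bump\<close> \<le> 1 and \<open>bump\<close> vanishes off
    the unit ball, local integrability of \<open>f\<close> on the closed ball provides the majorant.
    Integrability matters: a non-integrable function would have integral 0 by default.\<close>
  have int': "integrable lebesgue (\<lambda>x. bump x * f x)"
  proof (rule Bochner_Integration.integrable_bound[OF int])
    show "(\<lambda>x. bump x * f x) \<in> borel_measurable lebesgue"
      unfolding eq using meas borel_measurable_integrable[OF int] by (rule borel_measurable_times)
  qed (use le in auto)
  have nn: "bump x * f x \<ge> 0" for x
    using pos[of x] by (simp add: bump_nonneg)
  have "(LINT x|lebesgue. bump x * f x) \<noteq> 0"
  proof
    assume "(LINT x|lebesgue. bump x * f x) = 0"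
    then have "AE x in lebesgue. bump x * f x = 0"
      using integral_nonneg_eq_0_iff_AE[OF int'] nn by simp
    then have "AE x in lebesgue. x \<notin> ball (0::real^'d) 1"
      by eventually_elim (use pos bump_pos in \<open>force simp: less_le\<close>)
    then have "ball (0::real^'d) 1 \<in> null_sets lebesgue"
      by (subst AE_iff_null_sets) auto
    then have "negligible (ball (0::real^'d) 1)"
      by (simp add: negligible_iff_null_sets)
    then show False
      using open_not_negligible[of "ball (0::real^'d) 1"] by simp
  qed
  moreover have "(LINT x|lebesgue. bump x * f x) \<ge> 0"
    using nn by simp
  ultimately show ?thesis by simp
qed

section \<open>Affine changes of variables\<close>

lemma scaleR_affine_cancel:
  fixes x :: "'a::real_vector"
  assumes "c \<noteq> (0::real)"
  shows "inverse c *\<^sub>R (c *\<^sub>R x + b) - inverse c *\<^sub>R b = x"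
    and "c *\<^sub>R (inverse c *\<^sub>R x - inverse c *\<^sub>R b) + b = x"
  using assms by (simp_all add: algebra_simps)

section \<open>Change of variables in Lebesgue integrals\<close>

lemma measurable_lebesgue_affine:
  assumes "c \<noteq> (0::real)"
  shows "(\<lambda>x::'a::euclidean_space. c *\<^sub>R x + b) \<in> lebesgue \<rightarrow>\<^sub>M lebesgue"
proof -
  have "(\<lambda>x::'a. b + (\<Sum>j\<in>Basis. (c * (x \<bullet> j)) *\<^sub>R j)) \<in> lebesgue \<rightarrow>\<^sub>M lebesgue"
    by (rule lebesgue_affine_measurable) (use assms in auto)
  also have "(\<lambda>x::'a. b + (\<Sum>j\<in>Basis. (c * (x \<bullet> j)) *\<^sub>R j)) = (\<lambda>x. c *\<^sub>R x + b)"
    by (simp add: fun_eq_iff scaleR_sum_right[symmetric] scaleR_scaleR[symmetric] euclidean_representation del: scaleR_scaleR)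
  finally show ?thesis .
qed

text \<open>The general formula scales each coordinate by its own factor; with all factors equal to
  \<open>c\<close> the Jacobian is the product of \<open>DIM('a)\<close> copies of |c|.\<close>

lemma lebesgue_eq_density_affine:
  assumes "c \<noteq> (0::real)"
  shows "(lebesgue :: 'a::euclidean_space measure)
    = density (distr lebesgue lebesgue (\<lambda>x. c *\<^sub>R x + b)) (\<lambda>_. ennreal (\<bar>c\<bar> ^ DIM('a)))"
proof -
  have "(lebesgue :: 'a measure) = density (distr lebesgue lebesgue
      (\<lambda>x. b + (\<Sum>j\<in>Basis. (c * (x \<bullet> j)) *\<^sub>R j))) (\<lambda>_. (\<Prod>j\<in>(Basis::'a set). \<bar>c\<bar>))"
    by (rule lebesgue_affine_euclidean) (use assms in auto)
  also have "(\<lambda>x::'a. b + (\<Sum>j\<in>Basis. (c * (x \<bullet> j)) *\<^sub>R j)) = (\<lambda>x. c *\<^sub>R x + b)"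
    by (simp add: fun_eq_iff scaleR_sum_right[symmetric] scaleR_scaleR[symmetric] euclidean_representation del: scaleR_scaleR)
  finally show ?thesis by simp
qed

lemma integrable_lebesgue_affine:
  fixes f :: "'a::euclidean_space \<Rightarrow> 'b::euclidean_space"
  assumes "integrable lebesgue f" and c: "c \<noteq> (0::real)"
  shows "integrable lebesgue (\<lambda>x. f (c *\<^sub>R x + b))"
proof -
  note [measurable] = measurable_lebesgue_affine[OF c, of b] borel_measurable_integrable[OF assms(1)]
  have "integrable (distr lebesgue lebesgue (\<lambda>x. c *\<^sub>R x + b)) (\<lambda>x. \<bar>c\<bar> ^ DIM('a) *\<^sub>R f x)"
    using assms(1) by (subst (asm) lebesgue_eq_density_affine[OF c, of b]) (simp add: integrable_density)
  from integrable_scaleR_right[OF this, of "inverse (\<bar>c\<bar> ^ DIM('a))"]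
  have "integrable (distr lebesgue lebesgue (\<lambda>x. c *\<^sub>R x + b)) f"
    using c by simp
  then show ?thesis
    by (simp add: integrable_distr_eq)
qed

lemma integral_lebesgue_affine:
  fixes f :: "'a::euclidean_space \<Rightarrow> 'b::euclidean_space"
  assumes c: "c \<noteq> (0::real)"
  shows "(LINT x|lebesgue. f x) = \<bar>c\<bar> ^ DIM('a) *\<^sub>R (LINT x|lebesgue. f (c *\<^sub>R x + b))"
proof (cases "integrable lebesgue f")
  case True
  note [measurable] = measurable_lebesgue_affine[OF c, of b] borel_measurable_integrable[OF True]
  show ?thesis
    by (subst (1) lebesgue_eq_density_affine[OF c, of b]) (simp add: integral_density integral_distr)
next
  case False
  \<comment> \<open>The inverse substitution would carry integrability back to \<open>f\<close>. So
    both integrals take the default value 0, and the formula holds for every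
    \<open>f\<close>.\<close>
  have "\<not> integrable lebesgue (\<lambda>x. f (c *\<^sub>R x + b))"
  proof
    assume "integrable lebesgue (\<lambda>x. f (c *\<^sub>R x + b))"
    from integrable_lebesgue_affine[OF this, of "inverse c" "- (inverse c *\<^sub>R b)"]
    show False using False c scaleR_affine_cancel(2)[OF c, of _ b] by simp
  qed
  with False show ?thesis by (simp add: not_integrable_integral_eq)
qed

section \<open>Function spaces and test functions under substitution and scaling\<close>

lemma L1_loc_affine:
  fixes f :: "real^'d \<Rightarrow> 'b::euclidean_space"
  assumes "L1_loc f" and c: "c \<noteq> (0::real)"
  shows "L1_loc (\<lambda>x. f (c *\<^sub>R x + b))"
  unfolding L1_loc_def
proof (intro allI impI)
  fix K :: "(real^'d) set"
  assume "compact K"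
  \<comment> \<open>The image of \<open>K\<close> is the compact set on which to use local
    integrability of \<open>f\<close>; by injectivity its indicator, composed with the affine map,
    is the indicator of \<open>K\<close>.\<close>
  then have "compact ((\<lambda>x. c *\<^sub>R x + b) ` K)"
    by (intro compact_continuous_image continuous_intros)
  then have "integrable lebesgue (\<lambda>x. indicator ((\<lambda>x. c *\<^sub>R x + b) ` K) x *\<^sub>R f x)"
    using assms(1) by (simp add: L1_loc_def set_integrable_def)
  from integrable_lebesgue_affine[OF this c, of b]
  show "set_integrable lebesgue K (\<lambda>x. f (c *\<^sub>R x + b))"
    using c by (simp add: set_integrable_def indicator_def image_iff)
qed

lemma L1_loc_scaleR_left: "L1_loc f \<Longrightarrow> L1_loc (\<lambda>x. f x *\<^sub>R v)" for f :: "real^'d \<Rightarrow> real"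
  unfolding L1_loc_def set_integrable_def
proof (intro allI impI)
  fix K :: "(real^'d) set"
  assume "\<forall>K. compact K \<longrightarrow> integrable lebesgue (\<lambda>x. indicator K x *\<^sub>R f x)" "compact K"
  then have "integrable lebesgue (\<lambda>x. (indicator K x *\<^sub>R f x) *\<^sub>R v)"
    by (intro integrable_scaleR_left) auto
  then show "integrable lebesgue (\<lambda>x. indicator K x *\<^sub>R f x *\<^sub>R v)"
    by simp
qed

lemma L1_loc_scaleR_right: "L1_loc f \<Longrightarrow> L1_loc (\<lambda>x. r *\<^sub>R f x)"
  unfolding L1_loc_def set_integrable_def
proof (intro allI impI)
  fix K :: "(real^'a) set"
  assume "\<forall>K. compact K \<longrightarrow> integrable lebesgue (\<lambda>x. indicator K x *\<^sub>R f x)" "compact K"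
  then have "integrable lebesgue (\<lambda>x. r *\<^sub>R (indicator K x *\<^sub>R f x))"
    by (intro integrable_scaleR_right) auto
  then show "integrable lebesgue (\<lambda>x. indicator K x *\<^sub>R r *\<^sub>R f x)"
    by (simp add: mult.commute)
qed

lemma L2_affine:
  assumes "L2 f" and c: "c \<noteq> (0::real)"
  shows "L2 (\<lambda>x. f (c *\<^sub>R x + b))"
  unfolding L2_def
proof
  show "(\<lambda>x. f (c *\<^sub>R x + b)) \<in> borel_measurable lebesgue"
    using measurable_compose[OF measurable_lebesgue_affine[OF c]] assms(1)
    unfolding L2_def by blast
  show "integrable lebesgue (\<lambda>x. (norm (f (c *\<^sub>R x + b)))\<^sup>2)"
    using integrable_lebesgue_affine[of "\<lambda>x. (norm (f x))\<^sup>2", OF _ c] assms(1)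
    unfolding L2_def by blast
qed

lemma L2_scaleR_right: "L2 f \<Longrightarrow> L2 (\<lambda>x. r *\<^sub>R f x)"
  by (auto simp: L2_def power_mult_distrib)

lemma L2_scaleR_left:
  fixes f :: "real^'d \<Rightarrow> real" and v :: "'b::euclidean_space"
  assumes "L2 f"
  shows "L2 (\<lambda>x. f x *\<^sub>R v)"
  unfolding L2_def
proof
  have f: "f \<in> borel_measurable lebesgue" "integrable lebesgue (\<lambda>x. (norm (f x))\<^sup>2)"
    using assms by (auto simp only: L2_def)
  show "(\<lambda>x. f x *\<^sub>R v) \<in> borel_measurable lebesgue"
    by (intro borel_measurable_scaleR f borel_measurable_const)
  have "integrable lebesgue (\<lambda>x. (norm (f x))\<^sup>2 * (norm v)\<^sup>2)"
    by (intro integrable_mult_left f)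
  then show "integrable lebesgue (\<lambda>x. (norm (f x *\<^sub>R v))\<^sup>2)"
    by (simp only: norm_scaleR real_norm_def power_mult_distrib)
qed

text \<open>The set where the new function is nonzero lies in the image of the old compact support
  under the inverse affine map, hence is bounded.\<close>

lemma test_function_affine:
  fixes \<psi> :: "real^'d \<Rightarrow> real"
  assumes "test_function \<psi>" and c: "c \<noteq> (0::real)"
  shows "test_function (\<lambda>x. \<psi> (c *\<^sub>R x + b))"
proof -
  have "compact (closure {x. \<psi> x \<noteq> 0})"
    using assms(1) by (simp add: test_function_def)
  then have "bounded ((\<lambda>x. inverse c *\<^sub>R x - inverse c *\<^sub>R b) ` closure {x. \<psi> x \<noteq> 0})"
    by (intro compact_imp_bounded compact_continuous_image continuous_intros)
  moreover have "{x. \<psi> (c *\<^sub>R x + b) \<noteq> 0} \<subseteq> (\<lambda>x. inverse c *\<^sub>R x - inverse c *\<^sub>R b) ` closure {x. \<psi> x \<noteq> 0}"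
  proof
    fix x
    assume "x \<in> {x. \<psi> (c *\<^sub>R x + b) \<noteq> 0}"
    then show "x \<in> (\<lambda>x. inverse c *\<^sub>R x - inverse c *\<^sub>R b) ` closure {x. \<psi> x \<noteq> 0}"
      using scaleR_affine_cancel(1)[OF c, of x b]
      by (intro image_eqI[of _ _ "c *\<^sub>R x + b"] subsetD[OF closure_subset]) auto
  qed
  ultimately have "bounded {x. \<psi> (c *\<^sub>R x + b) \<noteq> 0}"
    by (rule bounded_subset)
  then have "compact (closure {x. \<psi> (c *\<^sub>R x + b) \<noteq> 0})"
    by simp
  moreover have "smooth (\<lambda>x. \<psi> (c *\<^sub>R x + b))"
    using assms(1) C_k_affine[of _ \<psi> 1 c b] by (simp add: test_function_def smooth_def)
  ultimately show ?thesis
    by (simp add: test_function_def)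
qed

section \<open>Affine substitution in weak derivatives and in the equation\<close>

lemma smooth_differentiable: "smooth f \<Longrightarrow> f differentiable (at x)"
  unfolding smooth_def by (drule spec[of _ "Suc 0"]) simp

lemma smooth_dir_deriv: "smooth f \<Longrightarrow> smooth (dir_deriv v f)"
  unfolding smooth_def by (metis C_k.simps(2)[THEN iffD1])

lemma laplacian_affine:
  assumes "smooth \<psi>"
  shows "laplacian (\<lambda>x. \<psi> (c *\<^sub>R x + b)) x = c\<^sup>2 * laplacian \<psi> (c *\<^sub>R x + b)"
proof -
  have 1: "dir_deriv v (\<lambda>x. \<psi> (c *\<^sub>R x + b)) = (\<lambda>x. c *\<^sub>R dir_deriv v \<psi> (c *\<^sub>R x + b))" for v
    using smooth_differentiable[OF assms] by (simp add: dir_deriv_affine fun_eq_iff)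
  have d: "dir_deriv v \<psi> differentiable (at x)" for v x
    by (intro smooth_differentiable smooth_dir_deriv assms)
  have "(\<lambda>x. dir_deriv v \<psi> (c *\<^sub>R x + b)) differentiable (at x)" for v x
    using d by (rule differentiable_compose) simp
  then have "dir_deriv v (\<lambda>x. c *\<^sub>R dir_deriv v \<psi> (c *\<^sub>R x + b)) x
      = c *\<^sub>R dir_deriv v (\<lambda>x. dir_deriv v \<psi> (c *\<^sub>R x + b)) x" for v x
    by (intro dir_deriv_eqI has_derivative_scaleR_right has_derivative_dir_deriv)
  with 1 d show ?thesis
    by (simp add: laplacian_def dir_deriv_affine sum_distrib_left power2_eq_square mult.assoc)
qed

text \<open>The substitution is moved onto the test function: \<psi> is written as \<phi> composed
  with the affine map, and the hypothesis is tested with \<phi>. Both integrals acquire the same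
  Jacobian \<open>m\<close>, which cancels, while the one derivative contributes the factor
  \<open>c\<close>.\<close>

lemma weak_partial_affine:
  fixes f h :: "real^'d \<Rightarrow> 'b::euclidean_space"
  assumes "weak_partial i f h" and c: "c \<noteq> (0::real)"
  shows "weak_partial i (\<lambda>x. f (c *\<^sub>R x + b)) (\<lambda>x. c *\<^sub>R h (c *\<^sub>R x + b))"
  unfolding weak_partial_def
proof (intro conjI allI impI L1_loc_scaleR_right L1_loc_affine c)
  show "L1_loc f" "L1_loc h"
    using assms by (auto simp: weak_partial_def)
  fix \<psi> :: "real^'d \<Rightarrow> real"
  assume \<psi>: "test_function \<psi>"
  define \<phi> where "\<phi> x = \<psi> (inverse c *\<^sub>R x + - (inverse c *\<^sub>R b))" for x
  have \<phi>: "test_function \<phi>"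
    unfolding \<phi>_def using c by (intro test_function_affine \<psi>) auto
  have \<psi>_eq: "\<psi> = (\<lambda>x. \<phi> (c *\<^sub>R x + b))"
    using c by (simp add: \<phi>_def fun_eq_iff scaleR_affine_cancel)
  have D: "dir_deriv v \<psi> x = c * dir_deriv v \<phi> (c *\<^sub>R x + b)" for v x
    unfolding \<psi>_eq using \<phi>
    by (intro dir_deriv_affine smooth_differentiable) (simp add: test_function_def)
  define m where "m = \<bar>c\<bar> ^ DIM(real^'d)"
  have comm: "\<psi> x *\<^sub>R c *\<^sub>R h y = c *\<^sub>R \<psi> x *\<^sub>R h y" for x y
    by (rule scaleR_left_commute)
  have "m *\<^sub>R (LINT x|lebesgue. dir_deriv (axis i 1) \<psi> x *\<^sub>R f (c *\<^sub>R x + b))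
      = c *\<^sub>R m *\<^sub>R (LINT x|lebesgue. dir_deriv (axis i 1) \<phi> (c *\<^sub>R x + b) *\<^sub>R f (c *\<^sub>R x + b))"
    by (simp add: D mult.commute flip: scaleR_scaleR) (simp add: mult.commute)
  also have "\<dots> = c *\<^sub>R (LINT x|lebesgue. dir_deriv (axis i 1) \<phi> x *\<^sub>R f x)"
    unfolding m_def by (simp only: integral_lebesgue_affine[OF c,
          of "\<lambda>x. dir_deriv (axis i 1) \<phi> x *\<^sub>R f x" b])
  also have "\<dots> = - (c *\<^sub>R (LINT x|lebesgue. \<phi> x *\<^sub>R h x))"
    using assms \<phi> by (simp add: weak_partial_def)
  also have "(LINT x|lebesgue. \<phi> x *\<^sub>R h x) = m *\<^sub>R (LINT x|lebesgue. \<psi> x *\<^sub>R h (c *\<^sub>R x + b))"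
    unfolding m_def \<psi>_eq by (rule integral_lebesgue_affine[OF c])
  also have "- (c *\<^sub>R \<dots>) = m *\<^sub>R - (LINT x|lebesgue. \<psi> x *\<^sub>R c *\<^sub>R h (c *\<^sub>R x + b))"
    by (simp add: comm scaleR_left_commute[of c m] del: scaleR_scaleR)
  finally show "(LINT x|lebesgue. dir_deriv (axis i 1) \<psi> x *\<^sub>R f (c *\<^sub>R x + b))
      = - (LINT x|lebesgue. \<psi> x *\<^sub>R c *\<^sub>R h (c *\<^sub>R x + b))"
    using c by (subst (asm) scaleR_cancel_left) (simp add: m_def)
qed

lemma H1_affine:
  assumes "H1 f" and c: "c \<noteq> (0::real)"
  shows "H1 (\<lambda>x. f (c *\<^sub>R x + b))"
  unfolding H1_def
proof (intro conjI allI)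
  show "L2 (\<lambda>x. f (c *\<^sub>R x + b))"
    using assms by (simp add: H1_def L2_affine)
  fix i
  obtain h where "L2 h" "weak_partial i f h"
    using assms(1) by (auto simp: H1_def)
  then show "\<exists>h. L2 h \<and> weak_partial i (\<lambda>x. f (c *\<^sub>R x + b)) h"
    using c by (intro exI[of _ "\<lambda>x. c *\<^sub>R h (c *\<^sub>R x + b)"])
      (simp add: L2_scaleR_right L2_affine weak_partial_affine)
qed

text \<open>As for weak derivatives, \<psi> is transported to \<phi> and the Jacobian cancels. The
  Laplacian now contributes \<open>c\<close> twice, so with \<open>c\<close> the square root of the
  desired frequency an equation of frequency 1 is rescaled to it.\<close>

lemma solves_distr_affine:
  fixes u f :: "real^'d \<Rightarrow> 'b::euclidean_space"
  assumes "solves_distr \<omega> u f" and c: "c \<noteq> (0::real)"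
  shows "solves_distr (c\<^sup>2 * \<omega>) (\<lambda>x. u (c *\<^sub>R x + b)) (\<lambda>x. c\<^sup>2 *\<^sub>R f (c *\<^sub>R x + b))"
  unfolding solves_distr_def
proof (intro conjI allI impI L1_loc_scaleR_right L1_loc_affine c)
  show "L1_loc u" "L1_loc f"
    using assms by (auto simp: solves_distr_def)
  fix \<psi> :: "real^'d \<Rightarrow> real"
  assume \<psi>: "test_function \<psi>"
  define \<phi> where "\<phi> x = \<psi> (inverse c *\<^sub>R x + - (inverse c *\<^sub>R b))" for x
  have \<phi>: "test_function \<phi>"
    unfolding \<phi>_def using c by (intro test_function_affine \<psi>) auto
  have \<psi>_eq: "\<psi> = (\<lambda>x. \<phi> (c *\<^sub>R x + b))"
    using c by (simp add: \<phi>_def fun_eq_iff scaleR_affine_cancel)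
  have L: "- laplacian \<psi> x + c\<^sup>2 * \<omega> * \<psi> x
      = c\<^sup>2 * (- laplacian \<phi> (c *\<^sub>R x + b) + \<omega> * \<phi> (c *\<^sub>R x + b))" for x
    using \<phi> laplacian_affine[of \<phi> c b x]
    by (simp add: \<psi>_eq test_function_def right_diff_distrib mult.assoc)
  define m where "m = \<bar>c\<bar> ^ DIM(real^'d)"
  have comm: "\<psi> x *\<^sub>R c\<^sup>2 *\<^sub>R f y = c\<^sup>2 *\<^sub>R \<psi> x *\<^sub>R f y" for x y
    by (rule scaleR_left_commute)
  have "m *\<^sub>R (LINT x|lebesgue. (- laplacian \<psi> x + c\<^sup>2 * \<omega> * \<psi> x) *\<^sub>R u (c *\<^sub>R x + b))
      = c\<^sup>2 *\<^sub>R m *\<^sub>R (LINT x|lebesgue.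
          (- laplacian \<phi> (c *\<^sub>R x + b) + \<omega> * \<phi> (c *\<^sub>R x + b)) *\<^sub>R u (c *\<^sub>R x + b))"
    unfolding L by (simp flip: scaleR_scaleR) (simp add: mult.commute)
  also have "\<dots> = c\<^sup>2 *\<^sub>R (LINT x|lebesgue. (- laplacian \<phi> x + \<omega> * \<phi> x) *\<^sub>R u x)"
    unfolding m_def by (simp only: integral_lebesgue_affine[OF c,
          of "\<lambda>x. (- laplacian \<phi> x + \<omega> * \<phi> x) *\<^sub>R u x" b])
  also have "\<dots> = c\<^sup>2 *\<^sub>R (LINT x|lebesgue. \<phi> x *\<^sub>R f x)"
    using assms \<phi> by (simp add: solves_distr_def)
  also have "(LINT x|lebesgue. \<phi> x *\<^sub>R f x) = m *\<^sub>R (LINT x|lebesgue. \<psi> x *\<^sub>R f (c *\<^sub>R x + b))"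
    unfolding m_def \<psi>_eq by (rule integral_lebesgue_affine[OF c])
  also have "c\<^sup>2 *\<^sub>R \<dots> = m *\<^sub>R (LINT x|lebesgue. \<psi> x *\<^sub>R c\<^sup>2 *\<^sub>R f (c *\<^sub>R x + b))"
    by (simp add: comm scaleR_left_commute[of "c\<^sup>2" m] del: scaleR_scaleR)
  finally show "(LINT x|lebesgue. (- laplacian \<psi> x + c\<^sup>2 * \<omega> * \<psi> x) *\<^sub>R u (c *\<^sub>R x + b))
      = (LINT x|lebesgue. \<psi> x *\<^sub>R c\<^sup>2 *\<^sub>R f (c *\<^sub>R x + b))"
    using c by (subst (asm) scaleR_cancel_left) (simp add: m_def)
qed

section \<open>Multiples of weak solutions\<close>

text \<open>Integrability of \<open>f\<close> is not assumed: for nonzero \<open>v\<close> the map y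
  \<mapsto> (y \<bullet> v) / (v \<bullet> v) is a bounded left inverse of r \<mapsto> r v, so both
  sides are integrable or neither is.\<close>

lemma integral_scaleR_left_vector:
  fixes f :: "'a \<Rightarrow> real" and v :: "'b::euclidean_space"
  shows "(LINT x|M. f x *\<^sub>R v) = (LINT x|M. f x) *\<^sub>R v"
proof (rule integral_bounded_linear'[of "\<lambda>r. r *\<^sub>R v" "\<lambda>y. (y \<bullet> v) / (v \<bullet> v)"])
  show "bounded_linear (\<lambda>y. (y \<bullet> v) / (v \<bullet> v))"
    by (intro bounded_linear_compose[OF bounded_linear_divide] bounded_linear_inner_left)
qed (auto simp: bounded_linear_scaleR_left)

lemma integral_scaleR_scaleR_vector:
  fixes f h :: "'a \<Rightarrow> real" and v :: "'b::euclidean_space"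
  shows "(LINT x|M. h x *\<^sub>R f x *\<^sub>R v) = (LINT x|M. h x *\<^sub>R f x) *\<^sub>R v"
  using integral_scaleR_left_vector[of M "\<lambda>x. h x *\<^sub>R f x" v] by simp

lemma H1_scaleR_left:
  fixes f :: "real^'d \<Rightarrow> real" and v :: "'b::euclidean_space"
  assumes "H1 f"
  shows "H1 (\<lambda>x. f x *\<^sub>R v)"
  unfolding H1_def
proof (intro conjI allI)
  show "L2 (\<lambda>x. f x *\<^sub>R v)"
    using assms by (simp add: H1_def L2_scaleR_left)
  fix i
  obtain h where h: "L2 h" "weak_partial i f h"
    using assms by (auto simp: H1_def)
  have "weak_partial i (\<lambda>x. f x *\<^sub>R v) (\<lambda>x. h x *\<^sub>R v)"
    using h(2) by (simp add: weak_partial_def L1_loc_scaleR_left integral_scaleR_scaleR_vector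
        del: scaleR_scaleR real_scaleR_def)
  with h(1) show "\<exists>h. L2 h \<and> weak_partial i (\<lambda>x. f x *\<^sub>R v) h"
    by (blast intro: L2_scaleR_left)
qed

lemma solves_distr_scaleR_left:
  fixes u f :: "real^'d \<Rightarrow> real" and v :: "'b::euclidean_space"
  assumes "solves_distr \<omega> u f"
  shows "solves_distr \<omega> (\<lambda>x. u x *\<^sub>R v) (\<lambda>x. f x *\<^sub>R v)"
  unfolding solves_distr_def
proof (intro conjI allI impI L1_loc_scaleR_left)
  show "L1_loc u" "L1_loc f"
    using assms by (auto simp only: solves_distr_def)
  fix \<psi> :: "real^'d \<Rightarrow> real"
  assume "test_function \<psi>"
  then have "(LINT x|lebesgue. (- laplacian \<psi> x + \<omega> * \<psi> x) *\<^sub>R u x) = (LINT x|lebesgue. \<psi> x *\<^sub>R f x)"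
    using assms by (simp only: solves_distr_def)
  then show "(LINT x|lebesgue. (- laplacian \<psi> x + \<omega> * \<psi> x) *\<^sub>R u x *\<^sub>R v)
      = (LINT x|lebesgue. \<psi> x *\<^sub>R f x *\<^sub>R v)"
    by (simp only: integral_scaleR_scaleR_vector)
qed

section \<open>The rescaled and translated ground state\<close>

lemma Q_scaled_translate:
  fixes Q :: "real^'d \<Rightarrow> real"
  assumes Q: "ground_state p Q" and p: "2 < p" and "\<omega> > 0" "a > 0"
  shows "H1 (\<lambda>x. Q_scaled p Q \<omega> a (x - y))"
    and "Q_scaled p Q \<omega> a x > 0"
    and "solves_distr \<omega> (\<lambda>x. Q_scaled p Q \<omega> a (x - y)) (\<lambda>x. a * Q_scaled p Q \<omega> a (x - y) powr (p - 1))"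
proof -
  \<comment> \<open>The amplitude satisfies a l^(p-2) = \<omega>. Rescaling space by
    \<open>c\<close> gives -\<Delta>v + \<omega> v = \<omega> v^(p-1), and multiplication by
    \<open>l\<close> turns the right hand side into \<omega> l v^(p-1) = a (l v)^(p-1).\<close>
  define l where "l = (\<omega> / a) powr (1 / (p - 2))"
  define c where "c = sqrt \<omega>"
  define b where "b = - (c *\<^sub>R y)"
  have l: "l > 0" and c: "c \<noteq> 0" and c2: "c\<^sup>2 = \<omega>"
    using assms by (simp_all add: l_def c_def)
  have eq: "(\<lambda>x. Q_scaled p Q \<omega> a (x - y)) = (\<lambda>x. Q (c *\<^sub>R x + b) *\<^sub>R l)"
    by (simp add: Q_scaled_def l_def c_def b_def fun_eq_iff scaleR_diff_right)
  have pos: "Q x > 0" for x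
    using Q unfolding ground_state_def by blast
  have "H1 Q" and solves: "solves_distr 1 Q (\<lambda>x. Q x powr (p - 1))"
    using Q unfolding ground_state_def by blast+
  show "Q_scaled p Q \<omega> a x > 0"
    unfolding Q_scaled_def using pos l by (simp add: l_def)
  show "H1 (\<lambda>x. Q_scaled p Q \<omega> a (x - y))"
    unfolding eq using \<open>H1 Q\<close> c by (intro H1_scaleR_left H1_affine)
  have "l powr (p - 1) = l powr (p - 2) * l"
    using l powr_add[of l "p - 2" 1] by simp
  also have "l powr (p - 2) = \<omega> / a"
    using assms by (simp add: l_def powr_powr)
  finally have lp: "a * l powr (p - 1) = \<omega> * l"
    using assms by simp
  have "solves_distr \<omega> (\<lambda>x. Q (c *\<^sub>R x + b) *\<^sub>R l)
      (\<lambda>x. (\<omega> *\<^sub>R Q (c *\<^sub>R x + b) powr (p - 1)) *\<^sub>R l)"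
    using solves_distr_affine[OF solves c, of b] by (intro solves_distr_scaleR_left) (simp add: c2)
  also have "(\<lambda>x. (\<omega> *\<^sub>R Q (c *\<^sub>R x + b) powr (p - 1)) *\<^sub>R l)
      = (\<lambda>x. a * Q_scaled p Q \<omega> a (x - y) powr (p - 1))"
  proof
    fix x
    have "a * Q_scaled p Q \<omega> a (x - y) powr (p - 1)
        = a * (Q (c *\<^sub>R x + b) powr (p - 1) * l powr (p - 1))"
      using fun_cong[OF eq, of x] pos l by (simp add: powr_mult less_imp_le)
    also have "\<dots> = Q (c *\<^sub>R x + b) powr (p - 1) * (\<omega> * l)"
      by (simp flip: lp)
    finally show "(\<omega> *\<^sub>R Q (c *\<^sub>R x + b) powr (p - 1)) *\<^sub>R l
        = a * Q_scaled p Q \<omega> a (x - y) powr (p - 1)"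
      by simp
  qed
  finally show "solves_distr \<omega> (\<lambda>x. Q_scaled p Q \<omega> a (x - y))
      (\<lambda>x. a * Q_scaled p Q \<omega> a (x - y) powr (p - 1))"
    unfolding eq .
qed

section \<open>The algebraic condition on \<open>w\<close>\<close>

lemma dir_deriv_homogeneous:
  fixes g :: "'a::real_normed_vector \<Rightarrow> real"
  assumes diff: "\<And>z. g differentiable (at z)"
    and hom: "\<And>z r. r \<ge> 0 \<Longrightarrow> g (r *\<^sub>R z) = r powr p * g z"
    and "r > 0"
  shows "dir_deriv v g (r *\<^sub>R z) = r powr (p - 1) * dir_deriv v g z"
proof -
  \<comment> \<open>Both sides of g(r z) = r^p g(z) are differentiated in \<open>z\<close>; the
    chain rule gives the extra \<open>r\<close> on the left, which lowers the degree to
    \<open>p - 1\<close>.\<close>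
  have "r * dir_deriv v g (r *\<^sub>R z) = dir_deriv v (\<lambda>z. g (r *\<^sub>R z)) z"
    using dir_deriv_affine[of g r z 0 v] diff by simp
  also have "\<dots> = dir_deriv v (\<lambda>z. r powr p * g z) z"
    using hom \<open>r > 0\<close> by simp
  also have "\<dots> = r powr p * dir_deriv v g z"
    using diff by (intro dir_deriv_eqI has_derivative_mult_right has_derivative_dir_deriv)
  finally show ?thesis
    using \<open>r > 0\<close> by (simp add: powr_diff field_simps)
qed

lemma nonlin_homogeneous:
  assumes "\<And>z. g differentiable (at z)"
    and "\<And>z r. r \<ge> 0 \<Longrightarrow> g (r *\<^sub>R z) = r powr p * g z"
    and "r > 0"
  shows "nonlin p g j (r *\<^sub>R z) = r powr (p - 1) *\<^sub>R nonlin p g j z"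
proof -
  have "dir_deriv v g (r *\<^sub>R z) = r powr (p - 1) * dir_deriv v g z" for v
    using assms by (rule dir_deriv_homogeneous)
  then show ?thesis
    by (simp add: nonlin_def dbar_def) (simp add: scaleR_conv_of_real algebra_simps)
qed

text \<open>The function r \<mapsto> g(r z) is differentiated at r = 1 twice, by the chain rule and
  from its explicit form r^p g(z); the two derivatives agree by uniqueness.\<close>

lemma dir_deriv_euler:
  fixes g :: "'a::real_normed_vector \<Rightarrow> real"
  assumes "g differentiable (at z)"
    and hom: "\<And>z r. r \<ge> 0 \<Longrightarrow> g (r *\<^sub>R z) = r powr p * g z"
  shows "dir_deriv z g z = p * g z"
proof -
  have "((\<lambda>r::real. r *\<^sub>R z) has_derivative (\<lambda>h. h *\<^sub>R z)) (at 1)"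
    by (auto intro!: derivative_eq_intros)
  then have 1: "((\<lambda>r. g (r *\<^sub>R z)) has_derivative (\<lambda>h. dir_deriv (h *\<^sub>R z) g z)) (at 1)"
    using has_derivative_compose[of "\<lambda>r::real. r *\<^sub>R z" _ 1 UNIV g]
      has_derivative_dir_deriv[OF assms(1)] by simp
  have "((\<lambda>r. r powr p * g z) has_real_derivative p * g z) (at 1)"
    by (auto intro!: derivative_eq_intros)
  \<comment> \<open>Homogeneity gives the explicit form for r \<ge> 0 only, so the derivative is
    transferred on the open half-line around 1.\<close>
  then have "((\<lambda>r. g (r *\<^sub>R z)) has_real_derivative p * g z) (at 1)"
    by (rule has_field_derivative_transform_within_open[of _ _ _ "{0<..}"]) (use hom in auto)
  then have "(\<lambda>h. dir_deriv (h *\<^sub>R z) g z) = (*) (p * g z)"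
    using 1 unfolding has_field_derivative_def by (rule has_derivative_unique[rotated])
  from fun_cong[OF this, of 1] show ?thesis by simp
qed

section \<open>Critical points on the sphere\<close>

lemma smooth_circle: "smooth (\<lambda>t::real. cos t *\<^sub>R w + sin t *\<^sub>R v)"
  unfolding smooth_def
proof
  fix k
  show "C_k k (\<lambda>t::real. cos t *\<^sub>R w + sin t *\<^sub>R v)"
  \<comment> \<open>Differentiating a curve of this form gives another one, with \<open>v\<close>
    and \<open>- w\<close> (scaled by the direction \<open>s\<close>) in the roles of
    \<open>w\<close> and \<open>v\<close>; hence both vectors stay arbitrary.\<close>
  proof (induction k arbitrary: w v)
    case 0
    show ?case by (auto intro!: continuous_intros)
  next
    case (Suc k)
    have D: "((\<lambda>t::real. cos t *\<^sub>R w + sin t *\<^sub>R v) has_derivative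
        (\<lambda>s. cos t *\<^sub>R (s *\<^sub>R v) + sin t *\<^sub>R (- s *\<^sub>R w))) (at t)" for t
      by (auto intro!: derivative_eq_intros simp: algebra_simps)
    then have "dir_deriv s (\<lambda>t::real. cos t *\<^sub>R w + sin t *\<^sub>R v)
        = (\<lambda>t. cos t *\<^sub>R (s *\<^sub>R v) + sin t *\<^sub>R (- s *\<^sub>R w))" for s
      by (intro ext dir_deriv_eqI)
    with D Suc show ?case
      by (auto simp only: C_k.simps differentiable_def)
  qed
qed

lemma unit_sphere_iff: "z \<in> unit_sphere \<longleftrightarrow> z \<bullet> z = 1"
  by (simp add: unit_sphere_def inner_vec_def dot_square_norm)

text \<open>Tangent vectors at \<open>w\<close> are realised by great circles through \<open>w\<close>.\<close>

lemma critical_point_on_unit_sphere_iff: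
  fixes g :: "complex^'n \<Rightarrow> real"
  assumes diff: "g differentiable (at w)" and w: "w \<in> unit_sphere"
  shows "critical_point_on g unit_sphere w \<longleftrightarrow> (\<forall>v. w \<bullet> v = 0 \<longrightarrow> dir_deriv v g w = 0)"
proof (intro iffI allI impI)
  have Dg: "(g has_derivative (\<lambda>v. dir_deriv v g w)) (at w)"
    using diff by (rule has_derivative_dir_deriv)
  {
    fix v
    assume crit: "critical_point_on g unit_sphere w" and v: "w \<bullet> v = 0"
    \<comment> \<open>Unit length of the tangent vector keeps the circle on the sphere. For
      \<open>v = 0\<close> the normalisation fails, and linearity of the differential settles the
      case.\<close>
    define v' where "v' = sgn v"
    show "dir_deriv v g w = 0"
    proof (cases "v = 0")
      case True
      then show ?thesis using linear_0[OF has_derivative_linear[OF Dg]] by simp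
    next
      case False
      define \<gamma> where "\<gamma> t = cos t *\<^sub>R w + sin t *\<^sub>R v'" for t :: real
      have ip: "w \<bullet> w = 1" "v' \<bullet> v' = 1" "w \<bullet> v' = 0" "v' \<bullet> w = 0"
        using w False v by (auto simp: unit_sphere_iff v'_def sgn_div_norm dot_square_norm
            power2_eq_square inner_commute field_simps)
      have "\<gamma> t \<bullet> \<gamma> t = (cos t)\<^sup>2 + (sin t)\<^sup>2" for t
        unfolding \<gamma>_def by (simp add: inner_add_left inner_add_right ip power2_eq_square)
      then have "range \<gamma> \<subseteq> unit_sphere"
        by (auto simp: unit_sphere_iff)
      moreover have "smooth \<gamma>"
        unfolding \<gamma>_def[abs_def] by (rule smooth_circle)
      moreover have "\<gamma> 0 = w" by (simp add: \<gamma>_def)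
      ultimately have 0: "((\<lambda>t. g (\<gamma> t)) has_real_derivative 0) (at 0)"
        using crit by (simp add: critical_point_on_def)
      have "(\<gamma> has_derivative (\<lambda>s. s *\<^sub>R v')) (at 0)"
        unfolding \<gamma>_def[abs_def] by (auto intro!: derivative_eq_intros)
      then have "((\<lambda>t. g (\<gamma> t)) has_derivative (\<lambda>s. dir_deriv (s *\<^sub>R v') g w)) (at 0)"
        by (rule has_derivative_compose) (simp add: \<open>\<gamma> 0 = w\<close> Dg)
      then have "(\<lambda>s. dir_deriv (s *\<^sub>R v') g w) = (*) 0"
        using 0 unfolding has_field_derivative_def by (rule has_derivative_unique)
      \<comment> \<open>Evaluating at \<open>s = norm v\<close> undoes the normalisation, as
        \<open>norm v\<close> times \<open>v'\<close> is \<open>v\<close>.\<close>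
      from fun_cong[OF this, of "norm v"] show ?thesis
        by (simp add: v'_def sgn_div_norm False)
    qed
  next
    assume tan: "\<forall>v. w \<bullet> v = 0 \<longrightarrow> dir_deriv v g w = 0"
    show "critical_point_on g unit_sphere w"
      unfolding critical_point_on_def
    proof (intro conjI allI impI w)
      fix \<gamma> :: "real \<Rightarrow> complex^'n"
      assume \<gamma>: "smooth \<gamma> \<and> range \<gamma> \<subseteq> unit_sphere \<and> \<gamma> 0 = w"
      then have D\<gamma>: "(\<gamma> has_derivative (\<lambda>s. dir_deriv s \<gamma> 0)) (at 0)"
        by (intro has_derivative_dir_deriv smooth_differentiable) auto
      \<comment> \<open>Differentiating the constant \<gamma> \<bullet> \<gamma> = 1 shows that the
        velocity at 0 is orthogonal to \<open>w\<close>, so the tangential hypothesis applies to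
        it.\<close>
      have "(\<lambda>t. \<gamma> t \<bullet> \<gamma> t) = (\<lambda>t. 1)"
        using \<gamma> by (auto simp: unit_sphere_iff image_subset_iff)
      then have "((\<lambda>t. \<gamma> t \<bullet> \<gamma> t) has_derivative (\<lambda>s. 0)) (at 0)"
        by simp
      from has_derivative_unique[OF has_derivative_inner[OF D\<gamma> D\<gamma>] this]
      have "w \<bullet> dir_deriv s \<gamma> 0 = 0" for s
        using \<gamma> by (auto simp: fun_eq_iff inner_commute)
      then have "dir_deriv (dir_deriv s \<gamma> 0) g w = 0" for s
        using tan by blast
      moreover have "((\<lambda>t. g (\<gamma> t)) has_derivative (\<lambda>s. dir_deriv (dir_deriv s \<gamma> 0) g w)) (at 0)"
        using has_derivative_compose[OF D\<gamma>, of g] Dg \<gamma> by auto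
      ultimately show "((\<lambda>t. g (\<gamma> t)) has_real_derivative 0) (at 0)"
        by (simp add: has_field_derivative_def lambda_zero)
    qed
  }
qed

text \<open>The factors 2/p and 1/2 combine to 1/p, so the real and imaginary parts of the j-th
  equation prescribe the derivatives along \<open>axis j 1\<close> and \<open>axis j \<i>\<close>.
  These vectors form the standard real basis, and two real linear maps that agree on it are
  equal.\<close>

lemma nonlin_eq_iff:
  fixes g :: "complex^'n \<Rightarrow> real"
  assumes diff: "g differentiable (at w)" and "p \<noteq> 0"
  shows "(\<forall>j. a *\<^sub>R (w $ j) = - nonlin p g j w) \<longleftrightarrow> (\<forall>v. dir_deriv v g w = - (p * a) * (w \<bullet> v))"
proof -
  have lin: "linear (\<lambda>v. dir_deriv v g w)"
    using has_derivative_linear[OF has_derivative_dir_deriv[OF diff]] .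
  have lin': "linear (\<lambda>v. - (p * a) * (w \<bullet> v))"
    by (intro bounded_linear.linear bounded_linear_const_mult bounded_linear_inner_right)
  have "a *\<^sub>R (w $ j) = - nonlin p g j w \<longleftrightarrow> dir_deriv (axis j 1) g w = - (p * a) * (w \<bullet> axis j 1)
      \<and> dir_deriv (axis j \<i>) g w = - (p * a) * (w \<bullet> axis j \<i>)" for j
    using \<open>p \<noteq> 0\<close>
    by (auto simp: nonlin_def dbar_def complex_eq_iff inner_axis inner_complex_def field_simps)
  then have "(\<forall>j. a *\<^sub>R (w $ j) = - nonlin p g j w)
      \<longleftrightarrow> (\<forall>b\<in>Basis. dir_deriv b g w = - (p * a) * (w \<bullet> b))"
    by (auto simp: Basis_vec_def Basis_complex_def)
  also have "\<dots> \<longleftrightarrow> (\<forall>v. dir_deriv v g w = - (p * a) * (w \<bullet> v))"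
    using linear_eq_stdbasis[OF lin lin'] by (auto simp: fun_eq_iff)
  finally show ?thesis .
qed

lemma nonlin_eq_iff_critical_point:
  fixes g :: "complex^'n \<Rightarrow> real"
  assumes diff: "g differentiable (at w)" and p: "p \<noteq> 0" and w: "w \<in> unit_sphere"
    and hom: "\<And>z r. r \<ge> 0 \<Longrightarrow> g (r *\<^sub>R z) = r powr p * g z"
  shows "(\<forall>j. a *\<^sub>R (w $ j) = - nonlin p g j w) \<longleftrightarrow> critical_point_on g unit_sphere w \<and> a = - g w"
proof -
  have lin: "linear (\<lambda>v. dir_deriv v g w)"
    using has_derivative_linear[OF has_derivative_dir_deriv[OF diff]] .
  have ww: "w \<bullet> w = 1"
    using w by (simp add: unit_sphere_iff)
  have euler: "dir_deriv w g w = p * g w"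
    using dir_deriv_euler[OF diff hom] .
  have "(\<forall>v. dir_deriv v g w = - (p * a) * (w \<bullet> v))
      \<longleftrightarrow> (\<forall>v. w \<bullet> v = 0 \<longrightarrow> dir_deriv v g w = 0) \<and> a = - g w"
  proof (intro iffI conjI allI impI)
    assume *: "\<forall>v. dir_deriv v g w = - (p * a) * (w \<bullet> v)"
    then show "dir_deriv v g w = 0" if "w \<bullet> v = 0" for v
      using that by simp
    show "a = - g w"
      using *[rule_format, of w]
    proof -
      assume "dir_deriv w g w = - (p * a) * (w \<bullet> w)"
      then have "p * (a + g w) = 0"
        by (simp add: euler ww algebra_simps)
      then show "a = - g w"
        using p by (simp add: eq_neg_iff_add_eq_0)
    qed
  next
    fix v
    assume *: "(\<forall>v. w \<bullet> v = 0 \<longrightarrow> dir_deriv v g w = 0) \<and> a = - g w"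
    \<comment> \<open>Subtracting the component along the unit vector \<open>w\<close> leaves a
      tangent vector; the radial remainder is evaluated by Euler's identity.\<close>
    have "dir_deriv (v - (w \<bullet> v) *\<^sub>R w) g w = 0"
      using * ww by (simp add: inner_diff_right)
    then show "dir_deriv v g w = - (p * a) * (w \<bullet> v)"
      using * by (simp add: linear_diff[OF lin] linear_scale[OF lin] euler)
  qed
  then show ?thesis
    using nonlin_eq_iff[OF diff p] critical_point_on_unit_sphere_iff[OF diff w] by simp
qed

theorem theorem1p3:
  fixes g :: "complex^'n \<Rightarrow> real"
    and Q :: "real^'d \<Rightarrow> real"
    and w :: "complex^'n"
    and p a :: real
  assumes "CARD('n) \<ge> 2"
    and "2 < p" and "ereal p < two_star CARD('d)"
    and "C_k 2 g"
    and "\<And>z r. r \<ge> 0 \<Longrightarrow> g (r *\<^sub>R z) = r powr p * g z"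
    and "ground_state p Q"
    and "w \<in> unit_sphere" and "a > 0"
  shows "(\<forall>\<omega>>0. R_set p Q w \<omega> a \<subseteq> solution_set (nonlin p g) \<omega>) \<longleftrightarrow>
    critical_point_on g unit_sphere w \<and> a = - g w \<and> - g w > 0"
proof -
  have diff: "g differentiable (at z)" for z
    using \<open>C_k 2 g\<close> by (simp add: numeral_2_eq_2)
  note hom = assms(5)
  have "w \<noteq> 0"
    using \<open>w \<in> unit_sphere\<close> by (auto simp: unit_sphere_iff)
  define U where "U \<omega> y x = Q_scaled p Q \<omega> a (x - y)" for \<omega> and y x :: "real^'d"
  note QS = Q_scaled_translate[OF \<open>ground_state p Q\<close> \<open>2 < p\<close> _ \<open>a > 0\<close>]
  have U_pos: "U \<omega> y x > 0" if "\<omega> > 0" for \<omega> y x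
    unfolding U_def using QS(2)[OF that] .
  have U_H1: "H1 (U \<omega> y)" if "\<omega> > 0" for \<omega> y
    unfolding U_def using QS(1)[OF that] .
  have U_solves: "solves_distr \<omega> (U \<omega> y) (\<lambda>x. a * U \<omega> y x powr (p - 1))" if "\<omega> > 0" for \<omega> y
    unfolding U_def using QS(3)[OF that] .
  have R_set_eq: "R_set p Q w \<omega> a = range (\<lambda>y x. U \<omega> y x *\<^sub>R w)" for \<omega>
    by (auto simp: R_set_def U_def)
  \<comment> \<open>At each point the positive number \<open>U \<omega> y x\<close> serves as the
    homogeneity factor, which separates the dependence on \<open>x\<close> from the constant
    \<open>nonlin p g j w\<close>.\<close>
  have nonlin_U: "nonlin p g j (U \<omega> y x *\<^sub>R w) = U \<omega> y x powr (p - 1) *\<^sub>R nonlin p g j w"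
    if "\<omega> > 0" for \<omega> y x j
    using nonlin_homogeneous[OF diff hom U_pos[OF that]] .
  have "(\<forall>\<omega>>0. R_set p Q w \<omega> a \<subseteq> solution_set (nonlin p g) \<omega>)
      \<longleftrightarrow> (\<forall>j. a *\<^sub>R (w $ j) = - nonlin p g j w)"
  proof (intro iffI allI impI)
    fix j
    assume "\<forall>\<omega>>0. R_set p Q w \<omega> a \<subseteq> solution_set (nonlin p g) \<omega>"
    \<comment> \<open>The single member with frequency 1 and centre 0 already yields the algebraic
      equations.\<close>
    then have "(\<lambda>x. U 1 0 x *\<^sub>R w) \<in> solution_set (nonlin p g) 1"
      using subsetD[OF _ rangeI[of "\<lambda>y x. U 1 y x *\<^sub>R w" 0]] by (simp add: R_set_eq)
    then have 1: "solves_distr 1 (\<lambda>x. U 1 0 x *\<^sub>R w $ j) (\<lambda>x. U 1 0 x powr (p - 1) *\<^sub>R - nonlin p g j w)"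
      by (simp add: solution_set_def nonlin_U)
    have 2: "solves_distr 1 (\<lambda>x. U 1 0 x *\<^sub>R w $ j) (\<lambda>x. (a * U 1 0 x powr (p - 1)) *\<^sub>R w $ j)"
      by (intro solves_distr_scaleR_left U_solves) simp
    define I where "I = (LINT x|lebesgue. bump x * (a * U 1 0 x powr (p - 1)))"
    have "L1_loc (\<lambda>x. a * U 1 0 x powr (p - 1))"
      using U_solves[of 1 0] by (simp add: solves_distr_def)
    then have "I > 0"
      unfolding I_def using U_pos[of 1 0] \<open>a > 0\<close> by (intro bump_integral_pos) (auto simp: less_le)
    \<comment> \<open>The facts \<open>1\<close> and \<open>2\<close> are equations for the same
      function, so their right hand sides have the same integral against
      \<open>bump\<close>.\<close>
    have "(LINT x|lebesgue. bump x *\<^sub>R (U 1 0 x powr (p - 1) *\<^sub>R - nonlin p g j w))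
        = (LINT x|lebesgue. bump x *\<^sub>R ((a * U 1 0 x powr (p - 1)) *\<^sub>R w $ j))"
      using 1 2 test_function_bump[where 'd='d] unfolding solves_distr_def
      by (elim conjE allE[of _ bump] impE) simp_all
    also have "\<dots> = I *\<^sub>R w $ j"
      using integral_scaleR_left_vector[where v = "w $ j"] by (simp add: I_def)
    \<comment> \<open>Inserting a/a makes the same positive scalar integral \<open>I\<close> appear
      on this side, so that it can be cancelled.\<close>
    also have "(LINT x|lebesgue. bump x *\<^sub>R (U 1 0 x powr (p - 1) *\<^sub>R - nonlin p g j w))
        = (LINT x|lebesgue. (bump x * (a * U 1 0 x powr (p - 1))) *\<^sub>R (- nonlin p g j w /\<^sub>R a))"
      using \<open>a > 0\<close> by (simp add: field_simps)
    also have "\<dots> = I *\<^sub>R (- nonlin p g j w /\<^sub>R a)"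
      unfolding I_def by (rule integral_scaleR_left_vector)
    finally have "- nonlin p g j w /\<^sub>R a = w $ j"
      using \<open>I > 0\<close> by (subst (asm) scaleR_cancel_left) simp
    then show "a *\<^sub>R (w $ j) = - nonlin p g j w"
      using \<open>a > 0\<close> by (metis less_irrefl scaleR_one scaleR_scaleR right_inverse)
  next
    fix \<omega> :: real
    assume eq: "\<forall>j. a *\<^sub>R (w $ j) = - nonlin p g j w" and \<omega>: "\<omega> > 0"
    have "(\<lambda>x. U \<omega> y x *\<^sub>R w) \<in> solution_set (nonlin p g) \<omega>" for y
      unfolding solution_set_def
    proof (intro CollectI conjI allI)
      \<comment> \<open>The function vanishes nowhere, so vanishing almost everywhere would make the
        whole space a null set.\<close>
      have "U \<omega> y x *\<^sub>R w \<noteq> 0" for x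
        using U_pos[OF \<omega>, of y x] \<open>w \<noteq> 0\<close> by simp
      then show "\<not> (AE x in lebesgue. U \<omega> y x *\<^sub>R w = 0)"
        by (simp add: eventually_False ae_filter_eq_bot_iff)
      fix j
      show "H1 (\<lambda>x. (U \<omega> y x *\<^sub>R w) $ j)"
        using H1_scaleR_left[OF U_H1[OF \<omega>]] by simp
      have "- nonlin p g j (U \<omega> y x *\<^sub>R w) = (a * U \<omega> y x powr (p - 1)) *\<^sub>R w $ j" for x
        using eq[rule_format, of j] unfolding nonlin_U[OF \<omega>]
        by (metis mult.commute scaleR_minus_right scaleR_scaleR)
      then show "solves_distr \<omega> (\<lambda>x. (U \<omega> y x *\<^sub>R w) $ j) (\<lambda>x. - nonlin p g j (U \<omega> y x *\<^sub>R w))"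
        using solves_distr_scaleR_left[OF U_solves[OF \<omega>]] by simp
    qed
    then show "R_set p Q w \<omega> a \<subseteq> solution_set (nonlin p g) \<omega>"
      by (auto simp: R_set_eq)
  qed
  also have "\<dots> \<longleftrightarrow> critical_point_on g unit_sphere w \<and> a = - g w"
    using \<open>2 < p\<close> by (intro nonlin_eq_iff_critical_point diff hom \<open>w \<in> unit_sphere\<close>) auto
  \<comment> \<open>The conjunct \<open>- g w > 0\<close> comes from \<open>a = - g w\<close> and
    \<open>a > 0\<close>.\<close>
  finally show ?thesis
    using \<open>a > 0\<close> by auto
qed

end
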